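(* Let $S$ be an inverse semigroup. There is a one-to-one correspondence between normal congruences on $E(S)$ and unital multiplicative invariant closed sets in $\widehat{E(S)}$.
   Context: An inverse semigroup is a semigroup $S$ in which every $s$ has a unique $s^*$ with $s=ss^*s$, $s^*=s^*ss^*$. $E(S)$ is the (commutative) semigroup of idempotents. A congruence on a semigroup is an equivalence relation compatible with left and right multiplication. A congruence $\rho$ on $E(S)$ is normal if $(e,f)\in\rho$ implies $(ses^*,sfs^* )\in\rho$ for all $s\in S$. $\widehat{E(S)}$ is the set of nonzero semigroup homomorphisms $E(S)\to\{0,1\}$ (usual product on $\{0,1\}$) with the topology of pointwise convergence. For $s\in S$ and $\xi\in\widehat{E(S)}$ with $\xi(s^*s)=1$, $\beta_s(\xi)\in\widehat{E(S)}$ is defined by $\beta_s(\xi)(e)=\xi(s^*es)$. A subset $F\subset\widehat{E(S)}$ is invariant if $\beta_s(\xi)\in F$ whenever $s\in S$, $\xi\in F$ and $\xi(s^*s)=1$; multiplicative if the pointwise product of two elements of $F$ belongs to $F$ whenever it is not zero; unital if it contains the constant function $1$. *)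

theory Defs
  imports "HOL-Analysis.Analysis"
begin

class inverse_semigroup = semigroup_mult +
  assumes ex1_generalized_inverse: "\<exists>!t. s = s * t * s \<and> t = t * s * t"

definition star :: "'a::inverse_semigroup \<Rightarrow> 'a" where
  "star s = (THE t. s = s * t * s \<and> t = t * s * t)"

definition idempotents :: "'a::inverse_semigroup set" where
  "idempotents = {e. e * e = e}"

definition idem_congruence :: "('a::inverse_semigroup \<times> 'a) set \<Rightarrow> bool" where
  "idem_congruence \<rho> \<longleftrightarrow>
     equiv idempotents \<rho> \<and>
     (\<forall>(e, f)\<in>\<rho>. \<forall>g\<in>idempotents. (g * e, g * f) \<in> \<rho> \<and> (e * g, f * g) \<in> \<rho>)"

definition normal_congruence :: "('a::inverse_semigroup \<times> 'a) set \<Rightarrow> bool" where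
  "normal_congruence \<rho> \<longleftrightarrow>
     idem_congruence \<rho> \<and> (\<forall>(e, f)\<in>\<rho>. \<forall>s. (s * e * star s, s * f * star s) \<in> \<rho>)"

text \<open>
  A function \<open>E(S) \<rightarrow> {0, 1}\<close> is an element of \<open>idempotents \<rightarrow>\<^sub>E {0, 1}\<close>: it takes the junk value
  \<open>undefined\<close> outside \<open>idempotents\<close>, so that equality of functions is equality on \<open>E(S)\<close>.
  The functions below built from characters are restricted accordingly.
\<close>

definition spectrum :: "('a::inverse_semigroup \<Rightarrow> nat) set" where
  "spectrum =
     {\<xi> \<in> idempotents \<rightarrow>\<^sub>E {0, 1}.
        (\<forall>e\<in>idempotents. \<forall>f\<in>idempotents. \<xi> (e * f) = \<xi> e * \<xi> f) \<and>
        \<xi> \<noteq> (\<lambda>e\<in>idempotents. 0)}"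

text \<open>The topology of pointwise convergence.\<close>

definition spectrum_topology :: "('a::inverse_semigroup \<Rightarrow> nat) topology" where
  "spectrum_topology =
     subtopology (product_topology (\<lambda>_. discrete_topology {0, 1}) idempotents) spectrum"

definition \<beta> :: "'a::inverse_semigroup \<Rightarrow> ('a \<Rightarrow> nat) \<Rightarrow> ('a \<Rightarrow> nat)" where
  "\<beta> s \<xi> = (\<lambda>e\<in>idempotents. \<xi> (star s * e * s))"

definition invariant :: "('a::inverse_semigroup \<Rightarrow> nat) set \<Rightarrow> bool" where
  "invariant F \<longleftrightarrow> (\<forall>s. \<forall>\<xi>\<in>F. \<xi> (star s * s) = 1 \<longrightarrow> \<beta> s \<xi> \<in> F)"

definition multiplicative :: "('a::inverse_semigroup \<Rightarrow> nat) set \<Rightarrow> bool" where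
  "multiplicative F \<longleftrightarrow>
     (\<forall>\<xi>\<in>F. \<forall>\<eta>\<in>F.
        (\<lambda>e\<in>idempotents. \<xi> e * \<eta> e) \<noteq> (\<lambda>e\<in>idempotents. 0) \<longrightarrow>
        (\<lambda>e\<in>idempotents. \<xi> e * \<eta> e) \<in> F)"

definition unital :: "('a::inverse_semigroup \<Rightarrow> nat) set \<Rightarrow> bool" where
  "unital F \<longleftrightarrow> (\<lambda>e\<in>idempotents. 1) \<in> F"

text \<open>
  The characters that factor through the quotient \<open>E(S) / \<rho>\<close>. This is the map that realises
  the correspondence between congruences and sets of characters.
\<close>

definition characters_of :: "('a::inverse_semigroup \<times> 'a) set \<Rightarrow> ('a \<Rightarrow> nat) set" where
  "characters_of \<rho> = {\<xi> \<in> spectrum. \<forall>(e, f)\<in>\<rho>. \<xi> e = \<xi> f}"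

end

theory Submission
  imports Defs
begin

text \<open>
  A normal congruence is recovered from its characters: if \<open>e\<close> and \<open>f\<close> are not congruent, one of
  the indicator functions of the principal filters generated by the classes of \<open>e\<close> and \<open>f\<close>
  separates them. Conversely, let \<open>F\<close> be a unital multiplicative invariant closed set and let
  \<open>\<xi>\<close> respect the congruence that \<open>F\<close> defines. Given a finite set \<open>A\<close> of idempotents, let \<open>e\<close> be
  the product of the members of \<open>A\<close> on which \<open>\<xi>\<close> is 1. For every other \<open>f\<close> in \<open>A\<close>, the idempotents
  \<open>e\<close> and \<open>e * f\<close> are not congruent, so some member of \<open>F\<close> is 1 at \<open>e\<close> and 0 at \<open>f\<close>. The product
  of these characters lies in \<open>F\<close> and agrees with \<open>\<xi>\<close> on \<open>A\<close>, whence \<open>\<xi>\<close> is in the closure of \<open>F\<close>.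
\<close>

section \<open>Idempotents of an inverse semigroup\<close>

lemma mult_star_mult: "s * star s * s = (s::'a::inverse_semigroup)"
  and star_mult_star: "star s * s * star s = star s"
  using theI'[OF ex1_generalized_inverse[of s]] unfolding star_def by simp_all

lemma star_unique:
  fixes s t :: "'a::inverse_semigroup"
  assumes "s * t * s = s" "t * s * t = t"
  shows "star s = t"
  using ex1_generalized_inverse[of s] assms mult_star_mult[of s] star_mult_star[of s] by metis

lemma star_star [simp]: "star (star s) = (s::'a::inverse_semigroup)"
  by (rule star_unique) (simp_all add: mult_star_mult star_mult_star)

lemma idempotents_iff: "e \<in> idempotents \<longleftrightarrow> e * e = e"
  by (simp add: idempotents_def)

lemma star_idempotent:
  "e \<in> idempotents \<Longrightarrow> star e = (e::'a::inverse_semigroup)"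
  by (rule star_unique) (simp_all add: idempotents_iff)

text \<open>Uniqueness of inverses forces the inverse \<open>x\<close> of \<open>e * f\<close> to
  absorb \<open>f\<close> on the left and \<open>e\<close> on the right. This makes \<open>x\<close>
  idempotent, hence its own inverse, so it equals \<open>e * f\<close>.\<close>

lemma idempotents_mult:
  fixes e f :: "'a::inverse_semigroup"
  assumes e: "e \<in> idempotents" and f: "f \<in> idempotents"
  shows "e * f \<in> idempotents"
proof -
  define x where "x = star (e * f)"
  have ee: "e * e = e" "\<And>y. e * (e * y) = e * y"
    and ff: "f * f = f" "\<And>y. f * (f * y) = f * y"
    using e f by (simp_all add: idempotents_iff flip: mult.assoc)
  have 1: "e * (f * (x * (e * f))) = e * f"
    using mult_star_mult[of "e * f"] by (simp add: x_def mult.assoc)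
  have 2: "x * (e * (f * x)) = x" "\<And>y. x * (e * (f * (x * y))) = x * y"
    using star_mult_star[of "e * f"] by (simp_all add: x_def flip: mult.assoc)
  have x: "x = f * (x * e)"
    unfolding x_def by (rule star_unique) (simp_all add: mult.assoc ee ff 1 2 flip: x_def)
  have "x * x = f * (x * e) * (f * (x * e))"
    by (simp only: x[symmetric])
  also have "\<dots> = f * (x * e)"
    by (simp add: mult.assoc 2)
  also have "\<dots> = x"
    by (rule x[symmetric])
  finally have "x \<in> idempotents"
    by (simp add: idempotents_iff)
  moreover from this have "e * f = x"
    using star_idempotent[of x] star_star[of "e * f"] by (simp add: x_def)
  ultimately show ?thesis
    by simp
qed

text \<open>Since products of idempotents are idempotent, \<open>f * e\<close> is an inverse of
  \<open>e * f\<close>; but the idempotent \<open>e * f\<close> is its own inverse.\<close>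

lemma idempotents_commute:
  fixes e f :: "'a::inverse_semigroup"
  assumes e: "e \<in> idempotents" and f: "f \<in> idempotents"
  shows "e * f = f * e"
proof -
  have ee: "e * e = e" "\<And>y. e * (e * y) = e * y"
    and ff: "f * f = f" "\<And>y. f * (f * y) = f * y"
    using e f by (simp_all add: idempotents_iff flip: mult.assoc)
  have "star (e * f) = f * e"
    using idempotents_mult[OF e f] idempotents_mult[OF f e]
    by (intro star_unique) (simp_all add: mult.assoc ee ff idempotents_iff)
  then show ?thesis
    using star_idempotent idempotents_mult[OF e f] by metis
qed

lemma star_mult_idempotent: "star s * s \<in> idempotents"
  by (simp add: idempotents_iff star_mult_star flip: mult.assoc)

lemma mult_star_idempotent: "s * star s \<in> idempotents"
  using star_mult_idempotent[of "star s"] by simp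

text \<open>The idempotent \<open>star s * s\<close> in the middle commutes past \<open>e\<close>
  and is then absorbed by \<open>s\<close>. So conjugation by \<open>s\<close> is multiplicative on
  idempotents, which makes \<open>\<beta> s \<xi>\<close> multiplicative.\<close>

lemma conjugate_mult:
  fixes s :: "'a::inverse_semigroup"
  assumes e: "e \<in> idempotents" and f: "f \<in> idempotents"
  shows "(s * e * star s) * (s * f * star s) = s * (e * f) * star s"
proof -
  have "(s * e * star s) * (s * f * star s) = s * (e * (star s * s)) * f * star s"
    by (simp add: mult.assoc)
  also have "\<dots> = s * ((star s * s) * e) * f * star s"
    using idempotents_commute[OF e star_mult_idempotent] by metis
  also have "\<dots> = (s * star s * s) * (e * f) * star s"
    by (simp add: mult.assoc)
  finally show ?thesis
    by (simp add: mult_star_mult)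
qed

lemma conjugate_idempotent:
  "e \<in> idempotents \<Longrightarrow> s * e * star s \<in> idempotents"
  using conjugate_mult[of e e s] by (simp add: idempotents_iff)

lemma conjugate_mult_star:
  "(s * star s) * (s * t * star s) = s * t * star s"
  using mult_star_mult[of s] by (simp flip: mult.assoc)

lemma idempotents_nonempty: "\<exists>e::'a::inverse_semigroup. e \<in> idempotents"
  using star_mult_idempotent by blast

section \<open>Characters\<close>

lemma spectrum_iff:
  "\<xi> \<in> spectrum \<longleftrightarrow>
     \<xi> \<in> idempotents \<rightarrow>\<^sub>E {0, 1} \<and>
     (\<forall>e\<in>idempotents. \<forall>f\<in>idempotents. \<xi> (e * f) = \<xi> e * \<xi> f) \<and>
     (\<exists>e\<in>idempotents. \<xi> e = 1)"
proof -
  have "(\<exists>e\<in>idempotents. \<xi> e = 1) \<longleftrightarrow> \<xi> \<noteq> (\<lambda>e\<in>idempotents. 0)"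
    if "\<xi> \<in> idempotents \<rightarrow>\<^sub>E {0, 1}"
    using that by (fastforce simp: fun_eq_iff restrict_def PiE_iff extensional_def)
  then show ?thesis
    by (auto simp: spectrum_def)
qed

lemma spectrum_cases:
  assumes "\<xi> \<in> spectrum" "e \<in> idempotents"
  obtains "\<xi> e = 0" | "\<xi> e = 1"
  using assms by (auto simp: spectrum_iff PiE_iff)

lemma spectrum_mult:
  "\<xi> \<in> spectrum \<Longrightarrow> e \<in> idempotents \<Longrightarrow> f \<in> idempotents \<Longrightarrow> \<xi> (e * f) = \<xi> e * \<xi> f"
  by (simp add: spectrum_iff)

lemma one_in_spectrum: "(\<lambda>e\<in>idempotents. 1) \<in> spectrum"
  using idempotents_nonempty by (auto simp: spectrum_iff idempotents_mult)

lemma mult_in_spectrum: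
  assumes "\<xi> \<in> spectrum" "\<eta> \<in> spectrum" "e \<in> idempotents" "\<xi> e * \<eta> e = 1"
  shows "(\<lambda>e\<in>idempotents. \<xi> e * \<eta> e) \<in> spectrum"
  using assms by (auto simp: spectrum_iff PiE_iff idempotents_mult)

lemma restrict_mult_nonzero:
  fixes \<xi> \<eta> :: "'a::inverse_semigroup \<Rightarrow> nat"
  assumes "(\<lambda>e\<in>idempotents. \<xi> e * \<eta> e) \<noteq> (\<lambda>e\<in>idempotents. 0)"
  shows "\<exists>e\<in>idempotents. \<xi> e * \<eta> e \<noteq> 0"
  using assms by (fastforce simp: fun_eq_iff)

lemma beta_in_spectrum:
  assumes \<xi>: "\<xi> \<in> spectrum" and s: "\<xi> (star s * s) = 1"
  shows "\<beta> s \<xi> \<in> spectrum"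
proof -
  have idem: "star s * e * s \<in> idempotents" if "e \<in> idempotents" for e
    using conjugate_idempotent[OF that, of "star s"] by simp
  have "\<beta> s \<xi> (e * f) = \<beta> s \<xi> e * \<beta> s \<xi> f"
    if "e \<in> idempotents" "f \<in> idempotents" for e f
    using that \<xi> conjugate_mult[OF that, of "star s"] idem
    by (simp add: \<beta>_def idempotents_mult flip: spectrum_mult)
  \<comment> \<open>The witness for non-vanishing: conjugating \<open>s * star s\<close> by
    \<open>star s\<close> gives \<open>star s * s\<close>, where \<xi> is 1.\<close>
  moreover have "\<beta> s \<xi> (s * star s) = 1"
    using s star_mult_star[of s] by (simp add: \<beta>_def mult_star_idempotent flip: mult.assoc)
  moreover have "\<beta> s \<xi> \<in> idempotents \<rightarrow>\<^sub>E {0, 1}"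
    using \<xi> idem by (auto simp: \<beta>_def spectrum_iff PiE_iff)
  ultimately show ?thesis
    using mult_star_idempotent[of s] unfolding spectrum_iff by blast
qed

section \<open>From congruences to sets of characters\<close>

lemma topspace_spectrum_topology: "topspace spectrum_topology = spectrum"
  unfolding spectrum_topology_def by (auto simp: spectrum_def)

text \<open>Evaluation at an idempotent is continuous into a discrete, hence Hausdorff,
  space.\<close>

lemma closedin_equalizer:
  assumes "e \<in> idempotents" "f \<in> idempotents"
  shows "closedin spectrum_topology {\<xi> \<in> spectrum. \<xi> e = \<xi> f}"
proof -
  have cont: "continuous_map spectrum_topology (discrete_topology {0, 1}) (\<lambda>\<xi>. \<xi> i)"
    if "i \<in> idempotents" for i
    using that unfolding spectrum_topology_def
    by (intro continuous_map_from_subtopology) (rule continuous_map_product_projection)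
  have "closedin spectrum_topology {\<xi> \<in> topspace spectrum_topology. \<xi> e = \<xi> f}"
    by (rule closedin_continuous_maps_eq[OF _ cont cont]) (use assms in auto)
  then show ?thesis
    by (simp add: topspace_spectrum_topology)
qed

lemma idem_congruence_subset:
  "idem_congruence \<rho> \<Longrightarrow> (e, f) \<in> \<rho> \<Longrightarrow> e \<in> idempotents \<and> f \<in> idempotents"
  by (auto simp: idem_congruence_def equiv_def refl_on_def)

lemma normal_congruence_imp_idem_congruence: "normal_congruence \<rho> \<Longrightarrow> idem_congruence \<rho>"
  by (simp add: normal_congruence_def)

lemma characters_of_closed:
  assumes "idem_congruence \<rho>"
  shows "closedin spectrum_topology (characters_of \<rho>)"
proof -
  \<comment> \<open>The factor \<open>topspace spectrum_topology\<close> keeps the formula correct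
    for an empty \<rho>, whose intersection would be the whole type.\<close>
  have "characters_of \<rho> =
      topspace spectrum_topology \<inter> (\<Inter>(e, f)\<in>\<rho>. {\<xi> \<in> spectrum. \<xi> e = \<xi> f})"
    by (auto simp: characters_of_def topspace_spectrum_topology)
  also have "closedin spectrum_topology \<dots>"
    using idem_congruence_subset[OF assms] closedin_equalizer
    by (cases "\<rho> = {}") (auto intro!: closedin_Int closedin_INT)
  finally show ?thesis .
qed

lemma characters_of_invariant:
  assumes "normal_congruence \<rho>"
  shows "invariant (characters_of \<rho>)"
  unfolding invariant_def
proof (intro allI ballI impI)
  fix s \<xi>
  assume \<xi>: "\<xi> \<in> characters_of \<rho>" and s: "\<xi> (star s * s) = 1"
  have "\<beta> s \<xi> e = \<beta> s \<xi> f" if "(e, f) \<in> \<rho>" for e f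
  proof -
    \<comment> \<open>Normality is applied to \<open>star s\<close>, because \<beta> conjugates by
      \<open>star s\<close>.\<close>
    have "(star s * e * s, star s * f * s) \<in> \<rho>"
      using assms that unfolding normal_congruence_def
      by (metis (mono_tags, lifting) case_prodD star_star)
    then show ?thesis
      using \<xi> that assms by (auto simp: characters_of_def \<beta>_def normal_congruence_def
          dest: idem_congruence_subset)
  qed
  then show "\<beta> s \<xi> \<in> characters_of \<rho>"
    using \<xi> s beta_in_spectrum by (auto simp: characters_of_def)
qed

lemma characters_of_multiplicative:
  assumes "idem_congruence \<rho>"
  shows "multiplicative (characters_of \<rho>)"
  unfolding multiplicative_def
proof (intro ballI impI)
  fix \<xi> \<eta>
  assume \<xi>: "\<xi> \<in> characters_of \<rho>" and \<eta>: "\<eta> \<in> characters_of \<rho>"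
    and "(\<lambda>e\<in>idempotents. \<xi> e * \<eta> e) \<noteq> (\<lambda>e\<in>idempotents. 0)"
  then obtain e where e: "e \<in> idempotents" "\<xi> e * \<eta> e \<noteq> 0"
    using restrict_mult_nonzero by blast
  moreover have "\<xi> \<in> spectrum" "\<eta> \<in> spectrum"
    using \<xi> \<eta> by (auto simp: characters_of_def)
  ultimately have "\<xi> e * \<eta> e = 1"
    by (auto elim: spectrum_cases)
  then have "(\<lambda>e\<in>idempotents. \<xi> e * \<eta> e) \<in> spectrum"
    using \<open>\<xi> \<in> spectrum\<close> \<open>\<eta> \<in> spectrum\<close> e(1) by (intro mult_in_spectrum)
  then show "(\<lambda>e\<in>idempotents. \<xi> e * \<eta> e) \<in> characters_of \<rho>"
    using \<xi> \<eta> idem_congruence_subset[OF assms] by (fastforce simp: characters_of_def)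
qed

lemma characters_of_unital:
  "idem_congruence \<rho> \<Longrightarrow> unital (characters_of \<rho>)"
  using one_in_spectrum idem_congruence_subset
  by (fastforce simp: unital_def characters_of_def)

section \<open>From sets of characters to congruences\<close>

definition congruence_of :: "('a::inverse_semigroup \<Rightarrow> nat) set \<Rightarrow> ('a \<times> 'a) set" where
  "congruence_of F = {(e, f). e \<in> idempotents \<and> f \<in> idempotents \<and> (\<forall>\<xi>\<in>F. \<xi> e = \<xi> f)}"

text \<open>The indicator of the principal filter generated by the class of \<open>e\<close> in \<open>E(S) / \<rho>\<close>.\<close>

definition filter_character ::
    "('a::inverse_semigroup \<times> 'a) set \<Rightarrow> 'a \<Rightarrow> 'a \<Rightarrow> nat" where
  "filter_character \<rho> e = (\<lambda>g\<in>idempotents. if (e * g, e) \<in> \<rho> then 1 else 0)"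

lemma filter_character_in_characters_of:
  assumes \<rho>: "idem_congruence \<rho>" and e: "e \<in> idempotents"
  shows "filter_character \<rho> e \<in> characters_of \<rho>"
proof -
  have refl: "(g, g) \<in> \<rho>" if "g \<in> idempotents" for g
    using \<rho> that by (auto simp: idem_congruence_def equiv_def refl_on_def)
  have sym: "(g, f) \<in> \<rho>" if "(f, g) \<in> \<rho>" for f g
    using \<rho> that by (auto simp: idem_congruence_def equiv_def dest: symD)
  have trans: "(f, h) \<in> \<rho>" if "(f, g) \<in> \<rho>" "(g, h) \<in> \<rho>" for f g h
    using \<rho> that by (auto simp: idem_congruence_def equiv_def dest: transD)
  have left: "(h * f, h * g) \<in> \<rho>" and right: "(f * h, g * h) \<in> \<rho>"
    if "(f, g) \<in> \<rho>" "h \<in> idempotents" for f g h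
    using \<rho> that by (auto simp: idem_congruence_def)
  \<comment> \<open>The filter is upward closed: \<open>e * (f * g)\<close> absorbs
    \<open>f\<close>, so multiplying the given pair by \<open>f\<close> relates it to
    \<open>e * f\<close>.\<close>
  have below: "(e * f, e) \<in> \<rho>"
    if f: "f \<in> idempotents" and g: "g \<in> idempotents" and fg: "(e * (f * g), e) \<in> \<rho>" for f g
  proof -
    have "e * (f * g) * f = e * (f * g)"
      using f g idempotents_commute[OF f g] by (metis idempotents_iff mult.assoc)
    then have "(e * (f * g), e * f) \<in> \<rho>"
      using right[OF fg f] by simp
    then show ?thesis
      using fg sym trans by blast
  qed
  have "(e * (f * g), e) \<in> \<rho> \<longleftrightarrow> (e * f, e) \<in> \<rho> \<and> (e * g, e) \<in> \<rho>"
    if f: "f \<in> idempotents" and g: "g \<in> idempotents" for f g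
  proof (intro iffI conjI)
    assume *: "(e * (f * g), e) \<in> \<rho>"
    show "(e * f, e) \<in> \<rho>"
      using below[OF f g *] .
    show "(e * g, e) \<in> \<rho>"
      using below[OF g f] * idempotents_commute[OF f g] by simp
  next
    assume *: "(e * f, e) \<in> \<rho> \<and> (e * g, e) \<in> \<rho>"
    then have "(e * f * g, e * g) \<in> \<rho>"
      using right g by blast
    then show "(e * (f * g), e) \<in> \<rho>"
      using * trans unfolding mult.assoc by blast
  qed
  moreover have "(e * e, e) \<in> \<rho>"
    using e refl by (simp add: idempotents_iff)
  ultimately have "filter_character \<rho> e \<in> spectrum"
    using e by (auto simp: spectrum_iff filter_character_def idempotents_mult)
  moreover have "filter_character \<rho> e f = filter_character \<rho> e g" if "(f, g) \<in> \<rho>" for f g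
  proof -
    have "(e * f, e) \<in> \<rho> \<longleftrightarrow> (e * g, e) \<in> \<rho>"
      using left[OF that e] sym trans by blast
    then show ?thesis
      using idem_congruence_subset[OF \<rho> that] by (simp add: filter_character_def)
  qed
  ultimately show ?thesis
    by (auto simp: characters_of_def)
qed

text \<open>The filter character of \<open>e\<close> is 1 at \<open>e\<close>, so it must be 1 at
  \<open>f\<close>, which says that \<open>e * f\<close> is congruent to \<open>e\<close>. By
  symmetry \<open>f * e\<close> is congruent to \<open>f\<close>, and the two products
  coincide.\<close>

lemma congruence_of_characters_of:
  assumes \<rho>: "idem_congruence \<rho>"
  shows "congruence_of (characters_of \<rho>) = \<rho>"
proof (intro equalityI subrelI)
  fix e f
  assume "(e, f) \<in> congruence_of (characters_of \<rho>)"
  then have e: "e \<in> idempotents" and f: "f \<in> idempotents"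
    and eq: "\<And>\<xi>. \<xi> \<in> characters_of \<rho> \<Longrightarrow> \<xi> e = \<xi> f"
    by (auto simp: congruence_of_def)
  have equiv: "equiv idempotents \<rho>"
    using \<rho> by (simp add: idem_congruence_def)
  have refl: "(e * e, e) \<in> \<rho>" "(f * f, f) \<in> \<rho>"
    using equiv e f by (auto simp: equiv_def refl_on_def idempotents_iff)
  have "(e * f, e) \<in> \<rho>"
    using eq[OF filter_character_in_characters_of[OF \<rho> e]] refl e f
    by (auto simp: filter_character_def split: if_splits)
  moreover have "(f * e, f) \<in> \<rho>"
    using eq[OF filter_character_in_characters_of[OF \<rho> f]] refl e f
    by (auto simp: filter_character_def split: if_splits)
  ultimately show "(e, f) \<in> \<rho>"
    using equiv idempotents_commute[OF e f] unfolding equiv_def by (metis symD transD)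
next
  fix e f
  assume "(e, f) \<in> \<rho>"
  then show "(e, f) \<in> congruence_of (characters_of \<rho>)"
    using idem_congruence_subset[OF \<rho>] by (auto simp: congruence_of_def characters_of_def)
qed

text \<open>For normality, a character \<xi> in \<open>F\<close> is examined at
  \<open>s * star s\<close>. If it is 0 there, it vanishes on every conjugate by \<open>s\<close>;
  if it is 1, invariance puts \<open>\<beta> (star s) \<xi>\<close> in \<open>F\<close>, and this
  character takes equal values on congruent idempotents.\<close>

lemma normal_congruence_congruence_of:
  assumes F: "F \<subseteq> spectrum" and inv: "invariant F"
  shows "normal_congruence (congruence_of F)"
proof -
  have "equiv idempotents (congruence_of F)"
    by (rule equivI) (auto simp: congruence_of_def refl_on_def sym_def trans_def)
  moreover have "(g * e, g * f) \<in> congruence_of F \<and> (e * g, f * g) \<in> congruence_of F"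
    if "(e, f) \<in> congruence_of F" "g \<in> idempotents" for e f g
    using that F by (auto simp: congruence_of_def idempotents_mult spectrum_mult subset_iff)
  moreover have "(s * e * star s, s * f * star s) \<in> congruence_of F"
    if ef: "(e, f) \<in> congruence_of F" for e f s
  proof -
    have e: "e \<in> idempotents" and f: "f \<in> idempotents"
      using ef by (auto simp: congruence_of_def)
    have "\<xi> (s * e * star s) = \<xi> (s * f * star s)" if \<xi>: "\<xi> \<in> F" for \<xi>
    proof -
      have spec: "\<xi> \<in> spectrum"
        using F \<xi> by blast
      from spec mult_star_idempotent[of s] show ?thesis
      proof (cases rule: spectrum_cases)
        case 1
        have "\<xi> (s * g * star s) = 0" if "g \<in> idempotents" for g
          using spectrum_mult[OF spec mult_star_idempotent conjugate_idempotent[OF that], of s s]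
            conjugate_mult_star[of s g] 1 by simp
        then show ?thesis
          using e f by simp
      next
        case 2
        then have "\<beta> (star s) \<xi> \<in> F"
          using inv \<xi> by (simp add: invariant_def)
        then have "\<beta> (star s) \<xi> e = \<beta> (star s) \<xi> f"
          using ef by (auto simp: congruence_of_def)
        then show ?thesis
          using e f by (simp add: \<beta>_def)
      qed
    qed
    then show ?thesis
      using e f conjugate_idempotent by (auto simp: congruence_of_def)
  qed
  ultimately show ?thesis
    by (auto simp: normal_congruence_def idem_congruence_def)
qed

section \<open>Approximation on finite sets and recovery of a closed set\<close>

lemma idempotents_finite_meet:
  assumes "finite A" "A \<subseteq> idempotents" "\<xi> \<in> spectrum" "\<forall>a\<in>A. \<xi> a = 1"
  shows "\<exists>e\<in>idempotents. \<xi> e = 1 \<and> (\<forall>\<eta>\<in>spectrum. \<eta> e = 1 \<longrightarrow> (\<forall>a\<in>A. \<eta> a = 1))"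
  using assms
proof (induction A rule: finite_induct)
  \<comment> \<open>The meet starts from any idempotent where \<xi> is 1, which exists because \<xi>
    is nonzero.\<close>
  case empty
  then show ?case
    by (auto simp: spectrum_iff)
next
  case (insert a A)
  then obtain e where e: "e \<in> idempotents" "\<xi> e = 1"
      "\<forall>\<eta>\<in>spectrum. \<eta> e = 1 \<longrightarrow> (\<forall>a\<in>A. \<eta> a = 1)"
    by auto
  then show ?case
    using insert.prems
    by (intro bexI[of _ "e * a"]) (auto simp: idempotents_mult spectrum_mult)
qed

lemma multiplicative_finite_product:
  assumes F: "F \<subseteq> spectrum" "multiplicative F" "unital F"
    and e: "e \<in> idempotents"
    and "finite B" "B \<subseteq> idempotents" "\<forall>f\<in>B. \<exists>\<eta>\<in>F. \<eta> e = 1 \<and> \<eta> f = 0"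
  shows "\<exists>\<eta>\<in>F. \<eta> e = 1 \<and> (\<forall>f\<in>B. \<eta> f = 0)"
  using assms(5-)
proof (induction B rule: finite_induct)
  \<comment> \<open>The empty product is the constant character 1, available since \<open>F\<close>
    is unital.\<close>
  case empty
  then show ?case
    using \<open>unital F\<close> e by (intro bexI[of _ "\<lambda>e\<in>idempotents. 1"]) (auto simp: unital_def)
next
  case (insert b B)
  then obtain \<eta> \<zeta> where \<eta>: "\<eta> \<in> F" "\<eta> e = 1" "\<forall>f\<in>B. \<eta> f = 0"
    and \<zeta>: "\<zeta> \<in> F" "\<zeta> e = 1" "\<zeta> b = 0"
    by auto
  \<comment> \<open>The common value 1 at \<open>e\<close> keeps the product nonzero, so
    multiplicativity of \<open>F\<close> applies.\<close>
  have "(\<lambda>g\<in>idempotents. \<eta> g * \<zeta> g) e \<noteq> (\<lambda>g\<in>idempotents. 0) e"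
    using e \<eta> \<zeta> by simp
  then have "(\<lambda>g\<in>idempotents. \<eta> g * \<zeta> g) \<in> F"
    using F(2) \<eta>(1) \<zeta>(1) unfolding multiplicative_def by metis
  moreover have "(\<lambda>g\<in>idempotents. \<eta> g * \<zeta> g) e = 1"
    using e \<eta>(2) \<zeta>(2) by simp
  moreover have "(\<lambda>g\<in>idempotents. \<eta> g * \<zeta> g) f = 0" if "f \<in> insert b B" for f
  proof -
    have "\<eta> f * \<zeta> f = 0"
      using that \<eta>(3) \<zeta>(3) by auto
    then show ?thesis
      using insert.prems(1) that by auto
  qed
  ultimately show ?case
    by blast
qed

lemma finite_approximation:
  assumes F: "F \<subseteq> spectrum" "multiplicative F" "unital F"
    and \<xi>: "\<xi> \<in> characters_of (congruence_of F)"
    and A: "finite A" "A \<subseteq> idempotents"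
  shows "\<exists>\<eta>\<in>F. \<forall>a\<in>A. \<eta> a = \<xi> a"
proof -
  have spec: "\<xi> \<in> spectrum"
    using \<xi> by (simp add: characters_of_def)
  obtain e where e: "e \<in> idempotents" "\<xi> e = 1"
    and ones: "\<And>\<eta> a. \<eta> \<in> spectrum \<Longrightarrow> \<eta> e = 1 \<Longrightarrow> a \<in> A \<Longrightarrow> \<xi> a = 1 \<Longrightarrow> \<eta> a = 1"
  proof -
    have "finite {a \<in> A. \<xi> a = 1}" "{a \<in> A. \<xi> a = 1} \<subseteq> idempotents"
      using A by auto
    from idempotents_finite_meet[OF this spec] show thesis
      using that by blast
  qed
  have zeros: "\<exists>\<eta>\<in>F. \<eta> e = 1 \<and> \<eta> f = 0" if "f \<in> {a \<in> A. \<xi> a = 0}" for f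
  proof -
    have f: "f \<in> idempotents" "\<xi> f = 0"
      using that A by auto
    \<comment> \<open>The character \<xi> respects the congruence, yet it is 0 at
      \<open>e * f\<close> and 1 at \<open>e\<close>.\<close>
    have "(e * f, e) \<notin> congruence_of F"
      using \<xi> e f spec spectrum_mult[OF spec e(1) f(1)] by (auto simp: characters_of_def)
    then obtain \<eta> where \<eta>: "\<eta> \<in> F" "\<eta> (e * f) \<noteq> \<eta> e"
      using e f by (auto simp: congruence_of_def idempotents_mult)
    then have "\<eta> \<in> spectrum"
      using F by blast
    \<comment> \<open>With values in {0, 1}, \<open>\<eta> e * \<eta> f\<close> differs from
      \<open>\<eta> e\<close> only in this case.\<close>
    then have "\<eta> e = 1 \<and> \<eta> f = 0"
      using \<eta> e(1) f(1) spectrum_mult[of \<eta> e f]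
      by (auto elim: spectrum_cases[of \<eta> e] spectrum_cases[of \<eta> f])
    then show ?thesis
      using \<eta> by blast
  qed
  obtain \<eta> where \<eta>: "\<eta> \<in> F" "\<eta> e = 1" "\<forall>f\<in>{a \<in> A. \<xi> a = 0}. \<eta> f = 0"
  proof -
    have "finite {a \<in> A. \<xi> a = 0}" "{a \<in> A. \<xi> a = 0} \<subseteq> idempotents"
      using A by auto
    from multiplicative_finite_product[OF F e(1) this] show thesis
      using that zeros by blast
  qed
  have "\<eta> a = \<xi> a" if a: "a \<in> A" for a
  proof -
    have "a \<in> idempotents"
      using a A by blast
    with spec show ?thesis
    proof (cases rule: spectrum_cases)
      case 1
      then show ?thesis
        using \<eta>(3) a by simp
    next
      case 2
      then show ?thesis
        using ones[of \<eta> a] \<eta>(1,2) a F(1) by auto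
    qed
  qed
  then show ?thesis
    using \<eta> by blast
qed

lemma characters_of_congruence_of:
  assumes F: "F \<subseteq> spectrum" "closedin spectrum_topology F" "multiplicative F" "unital F"
  shows "characters_of (congruence_of F) = F"
proof
  show "F \<subseteq> characters_of (congruence_of F)"
    using F by (auto simp: characters_of_def congruence_of_def)
  show "characters_of (congruence_of F) \<subseteq> F"
  proof
    fix \<xi>
    assume \<xi>: "\<xi> \<in> characters_of (congruence_of F)"
    let ?X = "product_topology (\<lambda>_. discrete_topology {0, 1::nat}) idempotents"
    obtain T where T: "closedin ?X T" "F = T \<inter> spectrum"
      using F(2) by (auto simp: spectrum_topology_def closedin_subtopology)
    have spec: "\<xi> \<in> spectrum"
      using \<xi> by (simp add: characters_of_def)
    show "\<xi> \<in> F"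
    proof (rule ccontr)
      assume "\<xi> \<notin> F"
      then have "\<xi> \<in> topspace ?X - T"
        using spec T by (auto simp: spectrum_iff)
      moreover have "openin ?X (topspace ?X - T)"
        using T by blast
      \<comment> \<open>A basic open box around \<xi> missing \<open>F\<close> constrains only
        finitely many coordinates; an element of \<open>F\<close> agreeing with \<xi> on these lies
        in the box, a contradiction.\<close>
      ultimately obtain U where U: "finite {i \<in> idempotents. U i \<noteq> {0, 1}}"
          "\<xi> \<in> PiE idempotents U" "PiE idempotents U \<subseteq> topspace ?X - T"
        unfolding openin_product_topology_alt topspace_discrete_topology by meson
      obtain \<eta> where \<eta>: "\<eta> \<in> F" "\<forall>i\<in>{i \<in> idempotents. U i \<noteq> {0, 1}}. \<eta> i = \<xi> i"
        using finite_approximation[OF F(1,3,4) \<xi> U(1)] by blast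
      have "\<eta> \<in> idempotents \<rightarrow>\<^sub>E {0, 1}"
        using \<eta>(1) F(1) unfolding spectrum_def by blast
      then have "\<eta> \<in> PiE idempotents U"
        using \<eta>(2) U(2) unfolding PiE_iff by (metis (mono_tags, lifting) mem_Collect_eq)
      then show False
        using U(3) \<eta>(1) T by blast
    qed
  qed
qed

theorem corollary3p1p6:
  shows "bij_betw characters_of
    {\<rho> :: ('a::inverse_semigroup \<times> 'a) set. normal_congruence \<rho>}
    {F :: ('a \<Rightarrow> nat) set. F \<subseteq> spectrum \<and> closedin spectrum_topology F \<and>
       invariant F \<and> multiplicative F \<and> unital F}"
\<comment> \<open>The inverse map sends a set of characters to the relation of not being separated
  by any of them.\<close>
proof (rule bij_betw_byWitness[where f' = congruence_of])
  show "characters_of ` {\<rho> :: ('a \<times> 'a) set. normal_congruence \<rho>} \<subseteq>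
    {F. F \<subseteq> spectrum \<and> closedin spectrum_topology F \<and>
       invariant F \<and> multiplicative F \<and> unital F}"
    using characters_of_closed characters_of_invariant characters_of_multiplicative
      characters_of_unital
    by (fastforce simp: normal_congruence_def characters_of_def)
qed (simp_all add: congruence_of_characters_of characters_of_congruence_of
    normal_congruence_congruence_of image_subset_iff normal_congruence_imp_idem_congruence)

end
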